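(* In the parameterization by $\beta$ of the deformations of the cusp $c_2$ of the orbifold $A$ (see context), the circle $$\left|\beta-\tfrac12-\tfrac i2\right|=\frac1{\sqrt2}$$ corresponds to the values of $(p,q)$ lying on the square (the boundary curve) with vertices at $(\pm2,\pm2)$. That is, with $(p,q)=(p(\beta),q(\beta))\in\mathbb{R}^2$ determined by $p\,u(\beta)+q\,v(\beta)=2\pi i$ as in the context (and extended by limits at the four points $\beta\in\{0,1,i,1+i\}$ of the circle), the set of values of $(p,q)$ as $\beta$ ranges over this circle is exactly the square $\{(p,q)\in\mathbb{R}^2:\max(|p|,|q|)=2\}$.
   Context: Origin of the parameters. Let $T^2=\mathbb{R}^2/\mathbb{Z}^2$. $A^*$ is the hyperbolic manifold obtained from $T^2\times(0,1)$ by removing the alternating two-component link $X\cup Y$, where $X,Y$ project to $\{y=x\}$ and $\{y=-x\}$, $X$ passes above $Y$ at $(0,0)$ and below it at $(1/2,1/2)$. Its cusps are $X$, $Y$, $W=T^2\times\{0\}$, $Z=T^2\times\{1\}$. $A$ is the two-cusped hyperbolic orbifold $A^*/\tau$, $\tau(x,y,t)=(x,-y,1-t)$, with cusps $c_1$ (image of $X$ and $Y$) and $c_2$ (image of $W$ and $Z$). Deformations of the hyperbolic structure of $A$ are parameterized by two complex numbers $\alpha,\beta$, the complete structure being $\alpha=\beta=\frac{1+i}2$; the holonomies of the meridian and longitude at $c_2$ depend only on $\beta$ and are $$m_W(\beta)=\frac{\beta(\beta-1)}{(\beta-i)(\beta-(1+i))},\qquad l_W(\beta)=\frac{\beta(\beta-i)}{(\beta-1)(\beta-(1+i))}.$$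 Dehn surgery coordinates. Let $u(\beta)=\log m_W(\beta)$ and $v(\beta)=\log l_W(\beta)$, where the logarithms are the continuous branches on the closed disc $|\beta-\frac12-\frac i2|\le\frac1{\sqrt2}$ minus the four points $0,1,i,1+i$, normalized by $u=v=0$ at $\beta=\frac{1+i}2$. The generalized Dehn surgery coefficient $(p,q)=(p_2,q_2)$ of $c_2$ at $\beta$ is the pair of real numbers with $p\,u(\beta)+q\,v(\beta)=2\pi i$ (defined where $u(\beta),v(\beta)$ are linearly independent over $\mathbb{R}$). At the points $0,1,i,1+i$, where $u,v$ are infinite, $(p,q)$ is understood as the limit along the circle. *)

theory Defs
  imports "HOL-Analysis.Analysis"
begin

definition m_W :: "complex \<Rightarrow> complex" where
  "m_W \<beta> = \<beta> * (\<beta> - 1) / ((\<beta> - \<i>) * (\<beta> - (1 + \<i>)))"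

definition l_W :: "complex \<Rightarrow> complex" where
  "l_W \<beta> = \<beta> * (\<beta> - \<i>) / ((\<beta> - 1) * (\<beta> - (1 + \<i>)))"

text \<open>The value of \<open>\<beta>\<close> at the complete structure.\<close>
definition complete_pt :: complex where
  "complete_pt = 1 / 2 + \<i> / 2"

text \<open>The zeros and poles of \<open>m_W\<close> and \<open>l_W\<close>.\<close>
definition corner_pts :: "complex set" where
  "corner_pts = {0, 1, \<i>, 1 + \<i>}"

definition beta_circle :: "complex set" where
  "beta_circle = {\<beta>. cmod (\<beta> - 1 / 2 - \<i> / 2) = 1 / sqrt 2}"

definition log_domain :: "complex set" where
  "log_domain = {\<beta>. cmod (\<beta> - 1 / 2 - \<i> / 2) \<le> 1 / sqrt 2} - corner_pts"

definition is_normalized_log :: "(complex \<Rightarrow> complex) \<Rightarrow> (complex \<Rightarrow> complex) \<Rightarrow> bool" where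
  "is_normalized_log f L \<longleftrightarrow>
     continuous_on log_domain L \<and> (\<forall>\<beta>\<in>log_domain. exp (L \<beta>) = f \<beta>) \<and> L complete_pt = 0"

text \<open>Only the values on \<^const>\<open>log_domain\<close> are meaningful. There the branches exist and are
  uniquely determined: see \<open>is_normalized_log_u\<close>, \<open>is_normalized_log_v\<close> and
  \<open>is_normalized_log_unique\<close> below.\<close>
definition u_W :: "complex \<Rightarrow> complex" where
  "u_W = (SOME L. is_normalized_log m_W L)"

definition v_W :: "complex \<Rightarrow> complex" where
  "v_W = (SOME L. is_normalized_log l_W L)"

text \<open>Linear independence over the reals of the pair \<open>(z, w)\<close>; in contrast to
  independence of the set \<open>{z, w}\<close>, this fails for \<open>z = w\<close>.\<close>
definition real_lin_indep :: "complex \<Rightarrow> complex \<Rightarrow> bool" where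
  "real_lin_indep z w \<longleftrightarrow> (\<forall>a b :: real. a *\<^sub>R z + b *\<^sub>R w = 0 \<longrightarrow> a = 0 \<and> b = 0)"

text \<open>Meaningful where \<open>u_W \<beta>\<close> and \<open>v_W \<beta>\<close> are linearly independent over the reals.\<close>
definition surgery_coeff :: "complex \<Rightarrow> real \<times> real" where
  "surgery_coeff \<beta> =
     (THE pq. of_real (fst pq) * u_W \<beta> + of_real (snd pq) * v_W \<beta> = 2 * of_real pi * \<i>)"

definition surgery_coeff_ext :: "complex \<Rightarrow> real \<times> real" where
  "surgery_coeff_ext \<beta> =
     (if \<beta> \<in> corner_pts then Lim (at \<beta> within beta_circle) surgery_coeff else surgery_coeff \<beta>)"


lemma log_domain_eq: "log_domain = cball complete_pt (1 / sqrt 2) - corner_pts"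
  by (auto simp: log_domain_def complete_pt_def dist_norm norm_minus_commute algebra_simps)

lemma corner_pts_sphere: "corner_pts \<subseteq> sphere complete_pt (1 / sqrt 2)"
  by (auto simp: corner_pts_def complete_pt_def dist_norm cmod_def power2_eq_square real_sqrt_divide)

lemma complete_pt_in_log_domain: "complete_pt \<in> log_domain"
  using corner_pts_sphere by (auto simp: log_domain_eq)

lemma starlike_log_domain: "starlike log_domain"
proof -
  have "closed_segment complete_pt x \<subseteq> log_domain" if x: "x \<in> log_domain" for x
  proof -
    have "open_segment complete_pt x \<subseteq> interior (cball complete_pt (1 / sqrt 2))"
      using x by (intro in_interior_closure_convex_segment) (auto simp: log_domain_eq)
    also have "\<dots> \<subseteq> log_domain"
      using corner_pts_sphere by (auto simp: log_domain_eq)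
    finally show ?thesis
      using x complete_pt_in_log_domain by (auto simp: closed_segment_eq_open)
  qed
  with complete_pt_in_log_domain show ?thesis
    unfolding starlike_def by blast
qed

lemma ex_normalized_log:
  assumes "continuous_on log_domain f" "\<And>z. z \<in> log_domain \<Longrightarrow> f z \<noteq> 0" "f complete_pt = 1"
  shows "\<exists>L. is_normalized_log f L"
proof -
  obtain g where g: "continuous_on log_domain g" "\<And>z. z \<in> log_domain \<Longrightarrow> f z = exp (g z)"
    using continuous_logarithm_on_contractible
      [OF assms(1) starlike_imp_contractible [OF starlike_log_domain] assms(2)] by blast
  have "exp (g complete_pt) = 1"
    using g(2) complete_pt_in_log_domain assms(3) by metis
  then have "is_normalized_log f (\<lambda>z. g z - g complete_pt)"
    using g by (auto simp: is_normalized_log_def exp_diff intro!: continuous_intros)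
  then show ?thesis by (intro exI [of "is_normalized_log f"])
qed

lemma is_normalized_log_u: "is_normalized_log m_W u_W"
  unfolding u_W_def
proof (rule someI_ex [of "is_normalized_log m_W"], rule ex_normalized_log)
  show "continuous_on log_domain m_W"
    unfolding m_W_def by (intro continuous_intros) (auto simp: log_domain_def corner_pts_def)
  show "m_W z \<noteq> 0" if "z \<in> log_domain" for z
    using that by (auto simp: m_W_def log_domain_def corner_pts_def)
  show "m_W complete_pt = 1"
    by (simp add: m_W_def complete_pt_def complex_eq_iff Re_divide Im_divide power2_eq_square)
qed

lemma is_normalized_log_v: "is_normalized_log l_W v_W"
  unfolding v_W_def
proof (rule someI_ex [of "is_normalized_log l_W"], rule ex_normalized_log)
  show "continuous_on log_domain l_W"
    unfolding l_W_def by (intro continuous_intros) (auto simp: log_domain_def corner_pts_def)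
  show "l_W z \<noteq> 0" if "z \<in> log_domain" for z
    using that by (auto simp: l_W_def log_domain_def corner_pts_def)
  show "l_W complete_pt = 1"
    by (simp add: l_W_def complete_pt_def complex_eq_iff Re_divide Im_divide power2_eq_square)
qed

lemma is_normalized_log_unique:
  assumes "is_normalized_log f L" "is_normalized_log f L'" "z \<in> log_domain"
  shows "L z = L' z"
proof -
  define d where "d = (\<lambda>z. L z - L' z)"
  have exp_d: "exp (d x) = 1" if "x \<in> log_domain" for x
    using assms that by (simp add: d_def is_normalized_log_def exp_diff) (metis exp_not_eq_zero)
  have "d constant_on log_domain"
  proof (rule continuous_discrete_range_constant)
    show "connected log_domain"
      by (rule starlike_imp_connected [OF starlike_log_domain])
    show "continuous_on log_domain d"
      using assms by (auto simp: d_def is_normalized_log_def intro!: continuous_intros)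
    fix x assume x: "x \<in> log_domain"
    have "2 * pi \<le> cmod (d y - d x)" if "y \<in> log_domain" "d y \<noteq> d x" for y
    proof -
      have "exp (d y - d x) = 1"
        using exp_d x that by (simp add: exp_diff)
      then obtain n :: int where n: "Re (d y - d x) = 0" "Im (d y - d x) = of_int (2 * n) * pi"
        unfolding exp_eq_1 by blast
      have eq: "d y - d x = of_real (of_int (2 * n) * pi) * \<i>"
        using n by (intro complex_eqI) auto
      with that(2) have "n \<noteq> 0" by auto
      then have "1 \<le> \<bar>real_of_int n\<bar>" by linarith
      then show ?thesis
        by (subst eq) (simp add: norm_mult abs_mult)
    qed
    then show "\<exists>e>0. \<forall>y. y \<in> log_domain \<and> d y \<noteq> d x \<longrightarrow> e \<le> cmod (d y - d x)"
      by (intro exI [of _ "2 * pi"]) auto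
  qed
  then have "d z = d complete_pt"
    using assms(3) complete_pt_in_log_domain by (auto simp: constant_on_def)
  then show ?thesis
    using assms by (simp add: d_def is_normalized_log_def)
qed

end

theory Submission
  imports Defs "HOL-Real_Asymp.Real_Asymp"
begin

text \<open>
  Put \<open>w = (\<beta> - c) / c\<close> with \<open>c = (1 + \<i>) / 2\<close>. This turns the closed disc into the unit disc and
  the four singular points into \<open>1, \<i>, -1, -\<i>\<close>. With \<open>L w = Ln ((1 + w) / (1 - w))\<close> the two
  holonomies factor so that \<open>u = L w - L (\<i> w)\<close> and \<open>v = L w + L (\<i> w)\<close>; these are the right
  branches, since the Cayley map \<open>w \<mapsto> (1 + w) / (1 - w)\<close> sends the disc without \<open>\<plusminus>1\<close> into the
  closed right half plane without 0, away from the slit of \<open>Ln\<close>.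

  On the unit circle, away from the singular points, the Cayley map is purely imaginary, and with \<open>w = x + \<i> y\<close>
  \[ L w = artanh x + \<i> (\<pi>/2) sgn y, \qquad L (\<i> w) = - artanh y + \<i> (\<pi>/2) sgn x. \]
  Write \<open>t = artanh x\<close>, \<open>s = artanh y\<close>. As \<open>t\<close> and \<open>s\<close> have the signs of \<open>x\<close> and \<open>y\<close>, the
  determinant of the real linear system \<open>p u + q v = 2 \<pi> \<i>\<close> is \<open>\<pi> (\<bar>s\<bar> + \<bar>t\<bar>) > 0\<close>
  (\<open>u_v_indep_circle\<close>), and its solution (\<open>surgery_coeff_circle\<close>) is
  \[ p = 2 (S - T), \quad q = 2 (S + T), \qquad S = s / (\<bar>s\<bar> + \<bar>t\<bar>), \quad T = t / (\<bar>s\<bar> + \<bar>t\<bar>). \]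
  So \<open>(S, T)\<close> lies on the diamond \<open>\<bar>S\<bar> + \<bar>T\<bar> = 1\<close>, which the linear map
  \<open>(S, T) \<mapsto> (p, q)\<close> carries onto the square.

  At a singular point one of \<open>s, t\<close> tends to zero and the other to \<open>\<plusminus>\<infinity>\<close>, so that \<open>(S, T)\<close>
  tends to a vertex of the diamond (\<open>surgery_coeff_corner\<close>). Every other point of the diamond is
  reached by the intermediate value theorem on one quarter of the circle, where \<open>t / s\<close> runs through
  all positive numbers, and by reflection in the coordinate axes (\<open>exists_circle_pt_direction\<close>).
\<close>

section \<open>The logarithms in a coordinate on the unit disc\<close>

definition disc_coord :: "complex \<Rightarrow> complex" where
  "disc_coord \<beta> = (\<beta> - complete_pt) / complete_pt"

lemma complete_pt_nz: "complete_pt \<noteq> 0"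
  by (simp add: complete_pt_def complex_eq_iff)

lemma norm_complete_pt: "cmod complete_pt = 1 / sqrt 2"
  by (simp add: complete_pt_def cmod_def power2_eq_square real_sqrt_divide)

lemma disc_coord_inverse: "complete_pt * (1 + disc_coord \<beta>) = \<beta>"
  using complete_pt_nz by (simp add: disc_coord_def field_simps)

lemma disc_coord_of: "disc_coord (complete_pt * (1 + w)) = w"
  using complete_pt_nz by (simp add: disc_coord_def field_simps)

lemma norm_disc_coord: "cmod (disc_coord \<beta>) = cmod (\<beta> - 1 / 2 - \<i> / 2) * sqrt 2"
  by (simp add: disc_coord_def norm_divide norm_complete_pt) (simp add: complete_pt_def diff_diff_eq)

lemma beta_circle_iff: "\<beta> \<in> beta_circle \<longleftrightarrow> cmod (disc_coord \<beta>) = 1"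
  by (simp add: beta_circle_def norm_disc_coord field_simps)

lemma log_domain_iff: "\<beta> \<in> log_domain \<longleftrightarrow> cmod (disc_coord \<beta>) \<le> 1 \<and> \<beta> \<notin> corner_pts"
  by (simp add: log_domain_def norm_disc_coord field_simps)

lemma factors_disc_coord:
  fixes \<beta> :: complex
  defines "w \<equiv> disc_coord \<beta>"
  shows "\<beta> = complete_pt * (w + 1)"
    and "\<beta> - 1 = complete_pt * (w + \<i>)"
    and "\<beta> - \<i> = complete_pt * (w - \<i>)"
    and "\<beta> - (1 + \<i>) = complete_pt * (w - 1)"
proof -
  have *: "\<beta> = complete_pt * (w + 1)"
    using disc_coord_inverse[of \<beta>] by (simp add: w_def add.commute)
  have c: "complete_pt * (1 - \<i>) = 1" "complete_pt * (1 + \<i>) = \<i>" "complete_pt * 2 = 1 + \<i>"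
    by (simp_all add: complete_pt_def complex_eq_iff)
  show "\<beta> = complete_pt * (w + 1)" by fact
  show "\<beta> - 1 = complete_pt * (w + \<i>)"
    by (subst *, subst c(1)[symmetric]) (simp add: algebra_simps)
  show "\<beta> - \<i> = complete_pt * (w - \<i>)"
    by (subst *, subst c(2)[symmetric]) (simp add: algebra_simps)
  show "\<beta> - (1 + \<i>) = complete_pt * (w - 1)"
    by (subst *, subst c(3)[symmetric]) (simp add: algebra_simps)
qed

lemma corner_pts_iff: "\<beta> \<in> corner_pts \<longleftrightarrow> disc_coord \<beta> \<in> {1, -1, \<i>, -\<i>}"
proof -
  have "\<beta> \<in> corner_pts \<longleftrightarrow> \<beta> = 0 \<or> \<beta> - 1 = 0 \<or> \<beta> - \<i> = 0 \<or> \<beta> - (1 + \<i>) = 0"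
    by (simp add: corner_pts_def)
  also have "\<dots> \<longleftrightarrow> disc_coord \<beta> + 1 = 0 \<or> disc_coord \<beta> + \<i> = 0 \<or> disc_coord \<beta> - \<i> = 0
      \<or> disc_coord \<beta> - 1 = 0"
    using factors_disc_coord[of \<beta>] complete_pt_nz by (metis mult_eq_0_iff)
  also have "\<dots> \<longleftrightarrow> disc_coord \<beta> \<in> {1, -1, \<i>, -\<i>}"
    by (auto simp: eq_neg_iff_add_eq_0)
  finally show ?thesis .
qed

lemma corner_pts_iff_circle:
  assumes "\<beta> \<in> beta_circle"
  shows "\<beta> \<in> corner_pts \<longleftrightarrow> Re (disc_coord \<beta>) = 0 \<or> Im (disc_coord \<beta>) = 0"
proof -
  have "(Re (disc_coord \<beta>))\<^sup>2 + (Im (disc_coord \<beta>))\<^sup>2 = 1"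
    using assms cmod_power2[of "disc_coord \<beta>"] by (simp add: beta_circle_iff)
  then show ?thesis
    by (auto simp: corner_pts_iff complex_eq_iff power2_eq_1_iff)
qed

text \<open>The branch \<open>L\<close>: twice the complex inverse hyperbolic tangent.\<close>
definition cayley_log :: "complex \<Rightarrow> complex" where
  "cayley_log w = Ln ((1 + w) / (1 - w))"

text \<open>If the Cayley image of \<open>w\<close> is a real number \<open>r \<le> 0\<close>, then \<open>w = (r - 1) / (r + 1)\<close>, which
  has modulus greater than one unless \<open>r = 0\<close> (and \<open>r = -1\<close> is not a value of the map).\<close>
lemma cayley_slit:
  assumes "cmod w \<le> 1" "w \<noteq> 1" "w \<noteq> -1"
  shows "(1 + w) / (1 - w) \<notin> \<real>\<^sub>\<le>\<^sub>0"
proof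
  assume "(1 + w) / (1 - w) \<in> \<real>\<^sub>\<le>\<^sub>0"
  then obtain r where r: "(1 + w) / (1 - w) = of_real r" "r \<le> 0"
    by (auto elim: nonpos_Reals_cases)
  then have eq: "1 + w = of_real r * (1 - w)"
    using assms(2) by (simp add: field_simps)
  have "w * of_real (1 + r) = of_real (r - 1)"
    using eq by (simp add: algebra_simps)
  then have "cmod w * \<bar>1 + r\<bar> = \<bar>r - 1\<bar>"
    by (metis norm_mult norm_of_real)
  moreover have "cmod w * \<bar>1 + r\<bar> \<le> \<bar>1 + r\<bar>"
    using assms(1) by (simp add: mult_left_le_one_le)
  ultimately have "r = 0" using r(2) by linarith
  with eq have "w = -1" by (simp add: eq_neg_iff_add_eq_0 add.commute)
  with assms(3) show False by simp
qed

text \<open>On the circle, \<open>(1 + w) / (1 - w) = \<i> y / (1 - x)\<close>, and \<open>y\<^sup>2 = (1 + x) (1 - x)\<close> makes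
  \<open>\<bar>y\<bar> / (1 - x)\<close> the square root of \<open>(1 + x) / (1 - x)\<close>, whose logarithm is \<open>artanh x\<close>.\<close>
lemma cayley_log_circle:
  assumes "cmod w = 1" "Im w \<noteq> 0"
  shows "cayley_log w = Complex (artanh (Re w)) (pi / 2 * sgn (Im w))"
proof -
  define x y where "x = Re w" and "y = Im w"
  have w: "w = Complex x y" by (simp add: x_def y_def)
  have y: "y \<noteq> 0" using assms by (simp add: y_def)
  have xy: "x\<^sup>2 + y\<^sup>2 = 1"
    using assms(1) cmod_power2[of w] by (simp add: x_def y_def)
  moreover have "y\<^sup>2 > 0" using y by simp
  ultimately have "x\<^sup>2 < 1" by linarith
  then have x: "\<bar>x\<bar> < 1" by (simp add: abs_square_less_1)
  have sq: "(1 + x) / (1 - x) = (\<bar>y\<bar> / (1 - x))\<^sup>2"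
  proof -
    have "y\<^sup>2 = (1 + x) * (1 - x)" using xy by (simp add: algebra_simps power2_eq_square)
    then show ?thesis using x by (simp add: power_divide power2_eq_square[of "1 - x"])
  qed
  have pos: "\<bar>y\<bar> / (1 - x) > 0" using x y by simp
  have "artanh x = ln (\<bar>y\<bar> / (1 - x))"
    unfolding artanh_def sq using pos by (simp add: ln_realpow)
  then have exp_artanh: "exp (artanh x) = \<bar>y\<bar> / (1 - x)"
    using pos by simp
  have "exp (Complex (artanh x) (pi / 2 * sgn y)) = Complex 0 (y / (1 - x))"
    using y x by (subst exp_eq_polar) (auto simp: complex_eq_iff exp_artanh sgn_if)
  also have "\<dots> = (1 + w) / (1 - w)"
  proof -
    have "1 - w \<noteq> 0" using y by (auto simp: w complex_eq_iff)
    moreover have "y / (1 - x) * y = 1 + x" "y / (1 - x) * (1 - x) = y"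
      using x xy by (simp_all add: divide_eq_eq algebra_simps power2_eq_square)
    then have "Complex 0 (y / (1 - x)) * (1 - w) = 1 + w"
      by (simp add: w complex_eq_iff)
    ultimately show ?thesis by (simp add: eq_divide_eq)
  qed
  finally show ?thesis
    unfolding cayley_log_def using y
    by (intro Ln_unique) (auto simp: x_def y_def sgn_if)
qed

text \<open>In the coordinate \<open>w\<close> the four linear factors of \<open>m_W\<close> and \<open>l_W\<close> are \<open>w + 1\<close>, \<open>w - 1\<close>,
  \<open>w + \<i>\<close>, \<open>w - \<i>\<close> up to the common factor \<open>c\<close>. The first two make up the Cayley image of \<open>w\<close>, the
  last two that of \<open>\<i> w\<close>, and \<open>m_W\<close>, \<open>l_W\<close> are the quotient and the product of these images.\<close>
lemma normalized_logs_cayley: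
  shows is_normalized_log_m_cayley: "is_normalized_log m_W
      (\<lambda>\<beta>. cayley_log (disc_coord \<beta>) - cayley_log (\<i> * disc_coord \<beta>))"
    and is_normalized_log_l_cayley: "is_normalized_log l_W
      (\<lambda>\<beta>. cayley_log (disc_coord \<beta>) + cayley_log (\<i> * disc_coord \<beta>))"
proof -
  let ?w = disc_coord
  have ne: "cmod (?w \<beta>) \<le> 1" "?w \<beta> \<noteq> 1" "?w \<beta> \<noteq> -1" "\<i> * ?w \<beta> \<noteq> 1" "\<i> * ?w \<beta> \<noteq> -1"
      "?w \<beta> \<noteq> \<i>" "?w \<beta> \<noteq> -\<i>"
    if "\<beta> \<in> log_domain" for \<beta>
    using that by (auto simp: log_domain_iff corner_pts_iff complex_eq_iff)
  have cw: "continuous_on log_domain ?w"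
    unfolding disc_coord_def using complete_pt_nz by (intro continuous_intros) auto
  have c1: "continuous_on log_domain (\<lambda>\<beta>. cayley_log (?w \<beta>))"
    unfolding cayley_log_def using ne by (intro continuous_intros cw cayley_slit) auto
  have c2: "continuous_on log_domain (\<lambda>\<beta>. cayley_log (\<i> * ?w \<beta>))"
    unfolding cayley_log_def using ne
    by (intro continuous_intros cw cayley_slit) (auto simp: norm_mult)
  have z: "?w complete_pt = 0" by (simp add: disc_coord_def)
  have nz: "1 - ?w \<beta> \<noteq> 0" "1 + ?w \<beta> \<noteq> 0" "?w \<beta> - 1 \<noteq> 0" "?w \<beta> - \<i> \<noteq> 0" "?w \<beta> + \<i> \<noteq> 0"
      "1 - \<i> * ?w \<beta> \<noteq> 0" "1 + \<i> * ?w \<beta> \<noteq> 0" if "\<beta> \<in> log_domain" for \<beta>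
  proof -
    have "\<i> * (?w \<beta> + \<i>) \<noteq> 0 \<and> \<i> * (?w \<beta> - \<i>) \<noteq> 0"
      using ne(6,7)[OF that] by (simp add: eq_neg_iff_add_eq_0)
    then show "1 - \<i> * ?w \<beta> \<noteq> 0" "1 + \<i> * ?w \<beta> \<noteq> 0"
      by (auto simp: algebra_simps)
  qed (use ne[OF that] in \<open>auto simp: eq_neg_iff_add_eq_0 add.commute\<close>)
  have e1: "exp (cayley_log (?w \<beta>)) = - ((?w \<beta> + 1) / (?w \<beta> - 1))" if "\<beta> \<in> log_domain" for \<beta>
  proof -
    have "(1 + ?w \<beta>) / (1 - ?w \<beta>) = - ((?w \<beta> + 1) / (?w \<beta> - 1))"
      by (metis add.commute minus_diff_eq minus_divide_right)
    then show ?thesis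
      using nz(1-3)[OF that] by (simp add: cayley_log_def add.commute)
  qed
  have e2: "exp (cayley_log (\<i> * ?w \<beta>)) = - ((?w \<beta> - \<i>) / (?w \<beta> + \<i>))"
    if "\<beta> \<in> log_domain" for \<beta>
  proof -
    have "(1 + \<i> * ?w \<beta>) * (?w \<beta> + \<i>) = - (?w \<beta> - \<i>) * (1 - \<i> * ?w \<beta>)"
      by (simp add: algebra_simps)
    then have eq: "(1 + \<i> * ?w \<beta>) / (1 - \<i> * ?w \<beta>) = - ((?w \<beta> - \<i>) / (?w \<beta> + \<i>))"
      unfolding minus_divide_left using nz[OF that] by (simp only: frac_eq_eq not_False_eq_True)
    have "exp (cayley_log (\<i> * ?w \<beta>)) = (1 + \<i> * ?w \<beta>) / (1 - \<i> * ?w \<beta>)"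
      using nz[OF that] by (simp add: cayley_log_def)
    then show ?thesis
      by (simp only: eq)
  qed
  have m: "m_W \<beta> = exp (cayley_log (?w \<beta>)) / exp (cayley_log (\<i> * ?w \<beta>))"
    if "\<beta> \<in> log_domain" for \<beta>
  proof -
    let ?c = complete_pt
    have "m_W \<beta> = (?c * (?w \<beta> + 1)) * (?c * (?w \<beta> + \<i>))
        / ((?c * (?w \<beta> - \<i>)) * (?c * (?w \<beta> - 1)))"
      by (simp only: m_W_def factors_disc_coord[symmetric])
    then show ?thesis
      unfolding e1[OF that] e2[OF that] using complete_pt_nz by (simp add: mult.commute)
  qed
  have l: "l_W \<beta> = exp (cayley_log (?w \<beta>)) * exp (cayley_log (\<i> * ?w \<beta>))"
    if "\<beta> \<in> log_domain" for \<beta>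
  proof -
    let ?c = complete_pt
    have "l_W \<beta> = (?c * (?w \<beta> + 1)) * (?c * (?w \<beta> - \<i>))
        / ((?c * (?w \<beta> + \<i>)) * (?c * (?w \<beta> - 1)))"
      by (simp only: l_W_def factors_disc_coord[symmetric])
    then show ?thesis
      unfolding e1[OF that] e2[OF that] using complete_pt_nz by (simp add: mult.commute)
  qed
  show "is_normalized_log m_W (\<lambda>\<beta>. cayley_log (?w \<beta>) - cayley_log (\<i> * ?w \<beta>))"
    using c1 c2 m z by (auto simp: is_normalized_log_def exp_diff intro: continuous_intros)
  show "is_normalized_log l_W (\<lambda>\<beta>. cayley_log (?w \<beta>) + cayley_log (\<i> * ?w \<beta>))"
    using c1 c2 l z
    by (auto simp: is_normalized_log_def exp_add cayley_log_def intro: continuous_intros)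
qed

text \<open>The quantities \<open>t\<close> and \<open>s\<close>: on the circle, the real parts of \<open>L w\<close> and \<open>- L (\<i> w)\<close>.\<close>
definition xlog :: "complex \<Rightarrow> real" where
  "xlog \<beta> = artanh (Re (disc_coord \<beta>))"

definition ylog :: "complex \<Rightarrow> real" where
  "ylog \<beta> = artanh (Im (disc_coord \<beta>))"

lemma unit_circle_coords_less_1:
  assumes "cmod w = 1" "Re w \<noteq> 0" "Im w \<noteq> 0"
  shows "\<bar>Re w\<bar> < 1" "\<bar>Im w\<bar> < 1"
proof -
  have "(Re w)\<^sup>2 + (Im w)\<^sup>2 = 1" "(Re w)\<^sup>2 > 0" "(Im w)\<^sup>2 > 0"
    using assms cmod_power2[of w] by simp_all
  then have "(Re w)\<^sup>2 < 1" "(Im w)\<^sup>2 < 1" by linarith+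
  then show "\<bar>Re w\<bar> < 1" "\<bar>Im w\<bar> < 1" by (simp_all add: abs_square_less_1)
qed

lemma u_v_circle:
  assumes "\<beta> \<in> beta_circle - corner_pts"
  defines "A \<equiv> Complex (xlog \<beta>) (pi / 2 * sgn (Im (disc_coord \<beta>)))"
    and "B \<equiv> Complex (- ylog \<beta>) (pi / 2 * sgn (Re (disc_coord \<beta>)))"
  shows "u_W \<beta> = A - B" and "v_W \<beta> = A + B"
proof -
  let ?w = "disc_coord \<beta>"
  have dom: "\<beta> \<in> log_domain" and w: "cmod ?w = 1" "Re ?w \<noteq> 0" "Im ?w \<noteq> 0"
    using assms(1) corner_pts_iff_circle by (auto simp: log_domain_iff beta_circle_iff)
  then have "\<bar>Im ?w\<bar> < 1"
    by (intro unit_circle_coords_less_1)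
  with w have "cayley_log ?w = A" "cayley_log (\<i> * ?w) = B"
    using cayley_log_circle[of ?w] cayley_log_circle[of "\<i> * ?w"] w
    by (auto simp: A_def B_def xlog_def ylog_def norm_mult)
  then show "u_W \<beta> = A - B" "v_W \<beta> = A + B"
    using is_normalized_log_unique[OF is_normalized_log_u is_normalized_log_m_cayley dom]
      is_normalized_log_unique[OF is_normalized_log_v is_normalized_log_l_cayley dom] by auto
qed

section \<open>The surgery coefficient on the circle\<close>

lemma sgn_artanh: "\<bar>x\<bar> < 1 \<Longrightarrow> sgn (artanh x) = sgn (x :: real)"
proof -
  have pos: "artanh x > 0" if "0 < x" "x < 1" for x :: real
    using that by (simp add: artanh_def)
  assume "\<bar>x\<bar> < 1"
  then show ?thesis
    using pos[of x] pos[of "-x"] by (cases x "0::real" rule: linorder_cases) auto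
qed

lemma circle_coords:
  assumes "\<beta> \<in> beta_circle - corner_pts"
  shows "sgn (xlog \<beta>) = sgn (Re (disc_coord \<beta>))" "sgn (ylog \<beta>) = sgn (Im (disc_coord \<beta>))"
    "xlog \<beta> \<noteq> 0"
    "\<bar>Re (disc_coord \<beta>)\<bar> < 1" "\<bar>Im (disc_coord \<beta>)\<bar> < 1"
proof -
  let ?w = "disc_coord \<beta>"
  have w: "cmod ?w = 1" "Re ?w \<noteq> 0" "Im ?w \<noteq> 0"
    using assms(1) corner_pts_iff_circle by (auto simp: beta_circle_iff)
  show "\<bar>Re ?w\<bar> < 1" "\<bar>Im ?w\<bar> < 1"
    using w by (auto intro: unit_circle_coords_less_1)
  then show 1: "sgn (xlog \<beta>) = sgn (Re ?w)" "sgn (ylog \<beta>) = sgn (Im ?w)"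
    by (auto simp: xlog_def ylog_def sgn_artanh)
  show "xlog \<beta> \<noteq> 0"
    using 1 w by (metis sgn_0_0)
qed

text \<open>A rotation by 45 degrees with a dilation. Since \<open>max \<bar>S - T\<bar> \<bar>S + T\<bar> = \<bar>S\<bar> + \<bar>T\<bar>\<close>, it carries
  the unit circle of the 1-norm to the circle of radius 2 of the maximum norm.\<close>
definition diamond_to_square :: "real \<Rightarrow> real \<Rightarrow> real \<times> real" where
  "diamond_to_square S T = (2 * (S - T), 2 * (S + T))"

lemma diamond_to_square_image:
  "(\<lambda>(S, T). diamond_to_square S T) ` {(S, T). \<bar>S\<bar> + \<bar>T\<bar> = 1} = {(p, q). max \<bar>p\<bar> \<bar>q\<bar> = 2}"
proof (intro subset_antisym subsetI)
  fix pq :: "real \<times> real" assume "pq \<in> {(p, q). max \<bar>p\<bar> \<bar>q\<bar> = 2}"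
  then obtain p q where pq: "pq = (p, q)" "max \<bar>p\<bar> \<bar>q\<bar> = 2" by auto
  have "pq = (\<lambda>(S, T). diamond_to_square S T) ((p + q) / 4, (q - p) / 4)"
    by (simp add: pq diamond_to_square_def field_simps)
  moreover have "\<bar>(p + q) / 4\<bar> + \<bar>(q - p) / 4\<bar> = 1"
    using pq(2) by (auto simp: max_def abs_if field_simps split: if_splits)
  ultimately show "pq \<in> (\<lambda>(S, T). diamond_to_square S T) ` {(S, T). \<bar>S\<bar> + \<bar>T\<bar> = 1}"
    by blast
qed (auto simp: diamond_to_square_def max_def abs_if split: if_splits)

lemma real_lin_indep_crossI:
  assumes "Re z * Im w - Im z * Re w \<noteq> 0"
  shows "real_lin_indep z w"
  unfolding real_lin_indep_def
proof (intro allI impI)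
  fix a b :: real assume "a *\<^sub>R z + b *\<^sub>R w = 0"
  then have eq: "a * Re z + b * Re w = 0" "a * Im z + b * Im w = 0"
    by (auto simp: complex_eq_iff)
  have "a * (Re z * Im w - Im z * Re w) = (a * Re z + b * Re w) * Im w - (a * Im z + b * Im w) * Re w"
    "b * (Re z * Im w - Im z * Re w) = (a * Im z + b * Im w) * Re z - (a * Re z + b * Re w) * Im z"
    by (auto simp: algebra_simps)
  then show "a = 0 \<and> b = 0" using eq assms by auto
qed

text \<open>The signs of the imaginary parts of \<open>A = L w\<close> and \<open>B = L (\<i> w)\<close> match those of the real parts
  so well that no cancellation is possible: the determinant of \<open>(A - B, A + B)\<close> is
  \<open>2 det (A, B) = \<pi> (s sgn s + t sgn t)\<close>.\<close>
lemma u_v_indep_circle: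
  assumes "\<beta> \<in> beta_circle - corner_pts"
  shows "real_lin_indep (u_W \<beta>) (v_W \<beta>)"
proof (rule real_lin_indep_crossI)
  have "Re (u_W \<beta>) * Im (v_W \<beta>) - Im (u_W \<beta>) * Re (v_W \<beta>)
      = pi * (sgn (xlog \<beta>) * xlog \<beta> + sgn (ylog \<beta>) * ylog \<beta>)"
    unfolding u_v_circle[OF assms] circle_coords(1,2)[OF assms] by (simp add: field_simps)
  also have "\<dots> = pi * (\<bar>xlog \<beta>\<bar> + \<bar>ylog \<beta>\<bar>)"
    by (simp add: abs_sgn mult.commute)
  also have "\<dots> > 0"
    using circle_coords(3)[OF assms] by (intro mult_pos_pos) auto
  finally show "Re (u_W \<beta>) * Im (v_W \<beta>) - Im (u_W \<beta>) * Re (v_W \<beta>) \<noteq> 0" by simp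
qed

lemma surgery_coeff_eqI:
  assumes "real_lin_indep (u_W \<beta>) (v_W \<beta>)"
    and "of_real p * u_W \<beta> + of_real q * v_W \<beta> = 2 * of_real pi * \<i>"
  shows "surgery_coeff \<beta> = (p, q)"
  unfolding surgery_coeff_def
proof (rule the_equality)
  fix r :: "real \<times> real"
  assume "of_real (fst r) * u_W \<beta> + of_real (snd r) * v_W \<beta> = 2 * of_real pi * \<i>"
  then have "(fst r - p) *\<^sub>R u_W \<beta> + (snd r - q) *\<^sub>R v_W \<beta> = 0"
    using assms(2) by (simp add: scaleR_conv_of_real algebra_simps)
  then have "fst r - p = 0 \<and> snd r - q = 0"
    using assms(1) unfolding real_lin_indep_def by blast
  then show "r = (p, q)" by (simp add: prod_eq_iff)
qed (use assms in simp)

text \<open>In terms of \<open>A = L w\<close> and \<open>B = L (\<i> w)\<close> the equation reads \<open>(q + p) A + (q - p) B = 2 \<pi> \<i>\<close>. Its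
  real part forces \<open>(q + p, q - p)\<close> to be proportional to \<open>(s, t)\<close>, and its imaginary part fixes the
  factor to be \<open>4 / (\<bar>s\<bar> + \<bar>t\<bar>)\<close>.\<close>
lemma surgery_coeff_circle:
  assumes "\<beta> \<in> beta_circle - corner_pts"
  defines "N \<equiv> \<bar>xlog \<beta>\<bar> + \<bar>ylog \<beta>\<bar>"
  shows "surgery_coeff \<beta> = diamond_to_square (ylog \<beta> / N) (xlog \<beta> / N)"
  unfolding diamond_to_square_def
proof (rule surgery_coeff_eqI[OF u_v_indep_circle[OF assms(1)]])
  let ?S = "ylog \<beta> / N" and ?T = "xlog \<beta> / N"
  let ?A = "Complex (xlog \<beta>) (pi / 2 * sgn (ylog \<beta>))"
  let ?B = "Complex (- ylog \<beta>) (pi / 2 * sgn (xlog \<beta>))"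
  have N: "N > 0" using circle_coords(3)[OF assms(1)] by (auto simp: N_def)
  have "of_real (2 * (?S - ?T)) * u_W \<beta> + of_real (2 * (?S + ?T)) * v_W \<beta>
      = 4 * (of_real ?S * ?A + of_real ?T * ?B)"
    unfolding u_v_circle[OF assms(1)] circle_coords(1,2)[OF assms(1)]
    by (simp add: algebra_simps)
  also have "of_real ?S * ?A + of_real ?T * ?B
      = Complex 0 (pi / 2 * ((ylog \<beta> * sgn (ylog \<beta>) + xlog \<beta> * sgn (xlog \<beta>)) / N))"
    using N by (simp add: complex_eq_iff field_simps)
  also have "ylog \<beta> * sgn (ylog \<beta>) + xlog \<beta> * sgn (xlog \<beta>) = N"
    by (simp add: N_def abs_sgn)
  finally show "of_real (2 * (?S - ?T)) * u_W \<beta> + of_real (2 * (?S + ?T)) * v_W \<beta>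
      = 2 * of_real pi * \<i>"
    using N by (simp add: complex_eq_iff)
qed

section \<open>The limits at the four corners\<close>

lemma filterlim_abs_artanh:
  assumes "(f \<longlongrightarrow> c) F" "\<bar>c\<bar> = 1" "eventually (\<lambda>x. \<bar>f x\<bar> < 1) F"
  shows "filterlim (\<lambda>x. \<bar>artanh (f x :: real)\<bar>) at_top F"
proof -
  have "filterlim (\<lambda>x. \<bar>f x\<bar>) (at_left 1) F"
    using tendsto_rabs[OF assms(1)] assms(2,3) by (auto simp: filterlim_at elim: eventually_mono)
  then have lim: "filterlim (\<lambda>x. artanh \<bar>f x\<bar>) at_top F"
    by (rule filterlim_compose[OF artanh_real_at_left_1])
  have "eventually (\<lambda>x. artanh \<bar>f x\<bar> = \<bar>artanh (f x)\<bar>) F"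
    using assms(3)
  proof eventually_elim
    case (elim x)
    then have "sgn (artanh (f x)) = sgn (f x)" "artanh (- f x) = - artanh (f x)"
      by (auto simp: sgn_artanh)
    then show ?case by (auto simp: abs_if sgn_if split: if_splits)
  qed
  from filterlim_cong[OF refl refl this] lim show ?thesis by blast
qed

text \<open>The direction of \<open>(s, t)\<close>, measured on the diamond, tends to a vertex when \<open>s\<close> tends to zero and
  \<open>t\<close> escapes to infinity on one side.\<close>
lemma tendsto_l1_normalized:
  fixes s t :: "'a \<Rightarrow> real"
  assumes "(s \<longlongrightarrow> 0) F" "filterlim (\<lambda>x. \<bar>t x\<bar>) at_top F" "eventually (\<lambda>x. sgn (t x) = \<sigma>) F"
  shows "((\<lambda>x. s x / (\<bar>s x\<bar> + \<bar>t x\<bar>)) \<longlongrightarrow> 0) F" "((\<lambda>x. t x / (\<bar>s x\<bar> + \<bar>t x\<bar>)) \<longlongrightarrow> \<sigma>) F"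
proof -
  have N: "filterlim (\<lambda>x. \<bar>s x\<bar> + \<bar>t x\<bar>) at_top F"
    by (rule filterlim_at_top_mono[OF assms(2)]) simp
  show "((\<lambda>x. s x / (\<bar>s x\<bar> + \<bar>t x\<bar>)) \<longlongrightarrow> 0) F"
    by (rule real_tendsto_divide_at_top[OF assms(1) N])
  have "((\<lambda>x. \<sigma> * (1 - \<bar>s x\<bar> / (\<bar>s x\<bar> + \<bar>t x\<bar>))) \<longlongrightarrow> \<sigma> * (1 - 0)) F"
    using tendsto_rabs_zero[OF assms(1)]
    by (intro tendsto_intros real_tendsto_divide_at_top[OF _ N])
  moreover have "eventually (\<lambda>x. \<sigma> * (1 - \<bar>s x\<bar> / (\<bar>s x\<bar> + \<bar>t x\<bar>)) = t x / (\<bar>s x\<bar> + \<bar>t x\<bar>)) F"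
    using assms(3) filterlim_at_top_dense[THEN iffD1, OF assms(2), rule_format, of 0]
  proof eventually_elim
    case (elim x)
    then have "\<sigma> * (1 - \<bar>s x\<bar> / (\<bar>s x\<bar> + \<bar>t x\<bar>)) = sgn (t x) * \<bar>t x\<bar> / (\<bar>s x\<bar> + \<bar>t x\<bar>)"
      by (simp add: field_simps)
    then show ?case by (simp add: sgn_mult_abs)
  qed
  ultimately show "((\<lambda>x. t x / (\<bar>s x\<bar> + \<bar>t x\<bar>)) \<longlongrightarrow> \<sigma>) F"
    by (simp add: tendsto_cong)
qed

lemma eventually_sgn:
  fixes f :: "'a \<Rightarrow> real"
  assumes "(f \<longlongrightarrow> c) F" "c \<noteq> 0"
  shows "eventually (\<lambda>x. sgn (f x) = sgn c) F"
proof (cases "c > 0")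
  case True
  then show ?thesis using order_tendstoD(1)[OF assms(1), of 0] by (auto elim: eventually_mono)
next
  case False
  then show ?thesis using assms order_tendstoD(2)[OF assms(1), of 0] by (auto elim: eventually_mono)
qed

text \<open>At a corner \<open>w\<close> is \<open>\<plusminus>1\<close> or \<open>\<plusminus>\<i>\<close>. One of \<open>x, y\<close> tends to 0, and so does its inverse hyperbolic
  tangent; the other tends to \<open>\<plusminus>1\<close>, where the inverse hyperbolic tangent is infinite. The limit is
  the same from both sides of the corner because the vanishing coordinate is the one that changes
  sign.\<close>
lemma surgery_coeff_corner:
  assumes "\<beta> \<in> corner_pts"
  shows "(surgery_coeff \<longlongrightarrow> diamond_to_square (Im (disc_coord \<beta>)) (Re (disc_coord \<beta>)))
    (at \<beta> within beta_circle)"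
proof -
  let ?F = "at \<beta> within beta_circle" and ?w = disc_coord
  have ev: "eventually (\<lambda>z. z \<in> beta_circle - corner_pts) ?F"
  proof -
    \<comment> \<open>The corners are isolated from each other, and the punctured filter omits \<open>\<beta>\<close> itself.\<close>
    have "open (- (corner_pts - {\<beta>}))"
      by (intro open_Compl finite_imp_closed) (simp add: corner_pts_def)
    then show ?thesis
      unfolding eventually_at_topological
      by (intro exI[of _ "- (corner_pts - {\<beta>})"]) auto
  qed
  have cont: "(?w \<longlongrightarrow> ?w \<beta>) ?F"
    unfolding disc_coord_def using complete_pt_nz by (intro tendsto_intros) auto
  have lim: "((\<lambda>z. Re (?w z)) \<longlongrightarrow> Re (?w \<beta>)) ?F" "((\<lambda>z. Im (?w z)) \<longlongrightarrow> Im (?w \<beta>)) ?F"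
    using cont by (auto intro: tendsto_intros)
  have lt1: "eventually (\<lambda>z. \<bar>Re (?w z)\<bar> < 1) ?F" "eventually (\<lambda>z. \<bar>Im (?w z)\<bar> < 1) ?F"
    using ev by (auto elim!: eventually_mono simp: circle_coords)
  have sg: "eventually (\<lambda>z. sgn (xlog z) = sgn (Re (?w z))) ?F"
     "eventually (\<lambda>z. sgn (ylog z) = sgn (Im (?w z))) ?F"
    using ev by (auto elim!: eventually_mono simp: circle_coords)
  have *: "((\<lambda>z. ylog z / (\<bar>xlog z\<bar> + \<bar>ylog z\<bar>)) \<longlongrightarrow> Im (?w \<beta>)) ?F \<and>
        ((\<lambda>z. xlog z / (\<bar>xlog z\<bar> + \<bar>ylog z\<bar>)) \<longlongrightarrow> Re (?w \<beta>)) ?F"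
  proof (cases "Im (?w \<beta>) = 0")
    case True
    then have r: "\<bar>Re (?w \<beta>)\<bar> = 1" using assms by (auto simp: corner_pts_iff)
    then have "sgn (Re (?w \<beta>)) = Re (?w \<beta>)" "Re (?w \<beta>) \<noteq> 0" by (auto simp: sgn_if abs_if split: if_splits)
    with eventually_sgn[OF lim(1)] sg(1) have "eventually (\<lambda>z. sgn (xlog z) = Re (?w \<beta>)) ?F"
      by (auto elim: eventually_elim2)
    moreover have "(ylog \<longlongrightarrow> 0) ?F"
      unfolding ylog_def using tendsto_artanh[OF lim(2)] True by simp
    moreover have "filterlim (\<lambda>z. \<bar>xlog z\<bar>) at_top ?F"
      unfolding xlog_def by (rule filterlim_abs_artanh[OF lim(1) r lt1(1)])
    ultimately show ?thesis
      using tendsto_l1_normalized[of ylog ?F xlog "Re (?w \<beta>)"] True by (simp add: add.commute)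
  next
    case False
    then have r: "\<bar>Im (?w \<beta>)\<bar> = 1" "Re (?w \<beta>) = 0" using assms by (auto simp: corner_pts_iff)
    then have "sgn (Im (?w \<beta>)) = Im (?w \<beta>)" by (auto simp: sgn_if abs_if split: if_splits)
    with eventually_sgn[OF lim(2) False] sg(2) have "eventually (\<lambda>z. sgn (ylog z) = Im (?w \<beta>)) ?F"
      by (auto elim: eventually_elim2)
    moreover have "(xlog \<longlongrightarrow> 0) ?F"
      unfolding xlog_def using tendsto_artanh[OF lim(1)] r by simp
    moreover have "filterlim (\<lambda>z. \<bar>ylog z\<bar>) at_top ?F"
      unfolding ylog_def by (rule filterlim_abs_artanh[OF lim(2) r(1) lt1(2)])
    ultimately show ?thesis
      using tendsto_l1_normalized[of xlog ?F ylog "Im (?w \<beta>)"] r by simp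
  qed
  have "((\<lambda>z. diamond_to_square (ylog z / (\<bar>xlog z\<bar> + \<bar>ylog z\<bar>)) (xlog z / (\<bar>xlog z\<bar> + \<bar>ylog z\<bar>)))
      \<longlongrightarrow> diamond_to_square (Im (?w \<beta>)) (Re (?w \<beta>))) ?F"
    unfolding diamond_to_square_def using * by (intro tendsto_intros) auto
  moreover have "eventually (\<lambda>z. surgery_coeff z =
      diamond_to_square (ylog z / (\<bar>xlog z\<bar> + \<bar>ylog z\<bar>)) (xlog z / (\<bar>xlog z\<bar> + \<bar>ylog z\<bar>))) ?F"
    using ev by eventually_elim (rule surgery_coeff_circle)
  ultimately show ?thesis by (simp add: tendsto_cong)
qed

lemma corner_pts_subset_circle: "corner_pts \<subseteq> beta_circle"
  by (auto simp: corner_pts_iff beta_circle_iff)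

text \<open>\<^const>\<open>Lim\<close> yields the limit only at an accumulation point; the circle is connected and has more
  than one point, so each of its points is one.\<close>
lemma surgery_coeff_ext_corner:
  assumes "\<beta> \<in> corner_pts"
  shows "surgery_coeff_ext \<beta> = diamond_to_square (Im (disc_coord \<beta>)) (Re (disc_coord \<beta>))"
proof -
  have "beta_circle = sphere complete_pt (1 / sqrt 2)"
    by (auto simp: beta_circle_def complete_pt_def dist_norm norm_minus_commute algebra_simps)
  then have "connected beta_circle"
    using connected_sphere[of complete_pt "1 / sqrt 2"] by simp
  moreover have "\<beta> \<in> beta_circle" using assms corner_pts_subset_circle by blast
  moreover have "beta_circle \<noteq> {x}" for x
    using corner_pts_subset_circle unfolding corner_pts_def
    by (metis insert_subset singletonD zero_neq_one)
  ultimately have "\<beta> islimpt beta_circle"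
    by (intro connected_imp_perfect) auto
  then have "at \<beta> within beta_circle \<noteq> bot" by (simp add: trivial_limit_within)
  then show ?thesis
    using assms tendsto_Lim[OF _ surgery_coeff_corner[OF assms]] by (simp add: surgery_coeff_ext_def)
qed

section \<open>Every direction is attained\<close>

text \<open>Intermediate value theorem on a quarter of the circle: at \<open>x = 0\<close> the right side is infinite, at
  \<open>x = 1\<close> the left side.\<close>
lemma exists_artanh_ratio:
  fixes a b :: real
  assumes "a > 0" "b > 0"
  shows "\<exists>x\<in>{0<..<1}. a * artanh x = b * artanh (sqrt (1 - x\<^sup>2))"
proof -
  define g where "g = (\<lambda>x::real. a * artanh x - b * artanh (sqrt (1 - x\<^sup>2)))"
  have "filterlim g at_bot (at_right 0)"
    unfolding g_def artanh_def using assms by real_asymp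
  then have "eventually (\<lambda>x. g x < 0) (at_right 0)"
    by (simp add: filterlim_at_bot_dense)
  then obtain d where d: "d > 0" "\<And>x. 0 < x \<Longrightarrow> x < d \<Longrightarrow> g x < 0"
    unfolding eventually_at_right_field by auto
  have "filterlim g at_top (at_left 1)"
    unfolding g_def artanh_def using assms by real_asymp
  then have "eventually (\<lambda>x. g x > 0) (at_left 1)"
    by (simp add: filterlim_at_top_dense)
  then obtain e where e: "e < 1" "\<And>x. e < x \<Longrightarrow> x < 1 \<Longrightarrow> g x > 0"
    unfolding eventually_at_left_field by auto
  \<comment> \<open>The bounds \<open>1/3\<close> and \<open>1/2\<close> only keep \<open>x0\<close> below \<open>x1\<close> and both inside the unit interval.\<close>
  define x0 where "x0 = min (1/3) (d / 2)"
  define x1 where "x1 = max (1/2) ((1 + e) / 2)"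
  have x0: "0 < x0" "x0 \<le> 1/3" "g x0 \<le> 0"
    using d(1) d(2)[of x0] by (auto simp: x0_def min_def intro: less_imp_le)
  have x1: "1/2 \<le> x1" "x1 < 1" "g x1 \<ge> 0"
    using e(1) e(2)[of x1] by (auto simp: x1_def max_def intro: less_imp_le)
  have sq: "0 < x\<^sup>2 \<and> x\<^sup>2 < 1" if "x0 \<le> x" "x \<le> x1" for x
    using that x0 x1 by (auto simp: power_less_one_iff)
  have "continuous_on {x0..x1} g"
    unfolding g_def
  proof (intro continuous_intros)
    show "{x0..x1} \<subseteq> {-1<..<1}" using x0 x1 by auto
    show "sqrt (1 - x\<^sup>2) \<in> {-1<..<1}" if "x \<in> {x0..x1}" for x
      using sq[of x] that by (auto intro: less_le_trans[of _ 0])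
  qed
  with x0 x1 obtain x where "x0 \<le> x" "x \<le> x1" "g x = 0"
    using IVT'[of g x0 0 x1] by auto
  with x0 x1 show ?thesis by (intro bexI[of _ x]) (auto simp: g_def)
qed

text \<open>A point of the first quarter with the right ratio \<open>\<bar>S\<bar> : \<bar>T\<bar>\<close> is reflected into the quarter
  given by the signs of \<open>S\<close> and \<open>T\<close>; \<open>artanh\<close> is odd, so this only changes the signs of
  \<open>s\<close> and \<open>t\<close>.\<close>
lemma exists_circle_pt_direction:
  fixes S T :: real
  assumes "\<bar>S\<bar> + \<bar>T\<bar> = 1" "S \<noteq> 0" "T \<noteq> 0"
  shows "\<exists>\<beta>\<in>beta_circle - corner_pts.
    ylog \<beta> / (\<bar>xlog \<beta>\<bar> + \<bar>ylog \<beta>\<bar>) = S \<and> xlog \<beta> / (\<bar>xlog \<beta>\<bar> + \<bar>ylog \<beta>\<bar>) = T"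
proof -
  obtain x where x: "0 < x" "x < 1" "\<bar>S\<bar> * artanh x = \<bar>T\<bar> * artanh (sqrt (1 - x\<^sup>2))"
    using exists_artanh_ratio[of "\<bar>S\<bar>" "\<bar>T\<bar>"] assms by auto
  define y where "y = sqrt (1 - x\<^sup>2)"
  have y: "0 < y" "y < 1" "x\<^sup>2 + y\<^sup>2 = 1"
    using x by (auto simp: y_def power_less_one_iff abs_square_le_1)
  define \<beta> where "\<beta> = complete_pt * (1 + Complex (sgn T * x) (sgn S * y))"
  have w: "disc_coord \<beta> = Complex (sgn T * x) (sgn S * y)"
    by (simp add: \<beta>_def disc_coord_of)
  have "(sgn T)\<^sup>2 = 1" "(sgn S)\<^sup>2 = 1" using assms by (auto simp: sgn_if)
  then have circ: "\<beta> \<in> beta_circle"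
    using y(3) by (simp add: beta_circle_iff w cmod_def power_mult_distrib)
  have "\<beta> \<notin> corner_pts"
    using corner_pts_iff_circle[OF circ] x y assms by (simp add: w sgn_0_0)
  have logs: "xlog \<beta> = sgn T * artanh x" "ylog \<beta> = sgn S * artanh y"
    using x y assms by (auto simp: xlog_def ylog_def w sgn_if)
  have pos: "artanh x > 0" "artanh y > 0"
    using sgn_artanh[of x] sgn_artanh[of y] x y by (simp_all add: sgn_1_pos)
  then have "\<bar>xlog \<beta>\<bar> + \<bar>ylog \<beta>\<bar> = artanh x + artanh y"
    using assms by (simp add: logs abs_mult abs_sgn_eq)
  moreover have "artanh y = \<bar>S\<bar> * (artanh x + artanh y)" "artanh x = \<bar>T\<bar> * (artanh x + artanh y)"
  proof -
    have "artanh y * (\<bar>S\<bar> + \<bar>T\<bar>) = \<bar>S\<bar> * (artanh x + artanh y)"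
      "artanh x * (\<bar>S\<bar> + \<bar>T\<bar>) = \<bar>T\<bar> * (artanh x + artanh y)"
      using x(3) by (simp_all add: y_def algebra_simps)
    then show "artanh y = \<bar>S\<bar> * (artanh x + artanh y)" "artanh x = \<bar>T\<bar> * (artanh x + artanh y)"
      using assms(1) by simp_all
  qed
  then have "artanh y / (artanh x + artanh y) = \<bar>S\<bar>" "artanh x / (artanh x + artanh y) = \<bar>T\<bar>"
    using pos by (simp_all add: divide_eq_eq)
  ultimately have "ylog \<beta> / (\<bar>xlog \<beta>\<bar> + \<bar>ylog \<beta>\<bar>) = sgn S * \<bar>S\<bar>"
      "xlog \<beta> / (\<bar>xlog \<beta>\<bar> + \<bar>ylog \<beta>\<bar>) = sgn T * \<bar>T\<bar>"
    by (simp_all add: logs times_divide_eq_right[symmetric] del: times_divide_eq_right)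
  then have "ylog \<beta> / (\<bar>xlog \<beta>\<bar> + \<bar>ylog \<beta>\<bar>) = S" "xlog \<beta> / (\<bar>xlog \<beta>\<bar> + \<bar>ylog \<beta>\<bar>) = T"
    by (simp_all add: sgn_mult_abs)
  with circ \<open>\<beta> \<notin> corner_pts\<close> show ?thesis by blast
qed

text \<open>The corners of the circle account for the vertices of the diamond, the open arcs between them for
  the open edges.\<close>
lemma surgery_coeff_ext_image:
  "surgery_coeff_ext ` beta_circle = (\<lambda>(S, T). diamond_to_square S T) ` {(S, T). \<bar>S\<bar> + \<bar>T\<bar> = 1}"
proof (intro subset_antisym subsetI)
  fix r assume "r \<in> surgery_coeff_ext ` beta_circle"
  then obtain \<beta> where \<beta>: "\<beta> \<in> beta_circle" "r = surgery_coeff_ext \<beta>" by auto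
  show "r \<in> (\<lambda>(S, T). diamond_to_square S T) ` {(S, T). \<bar>S\<bar> + \<bar>T\<bar> = 1}"
  proof (cases "\<beta> \<in> corner_pts")
    case True
    then have "\<bar>Im (disc_coord \<beta>)\<bar> + \<bar>Re (disc_coord \<beta>)\<bar> = 1"
      by (auto simp: corner_pts_iff)
    then show ?thesis using surgery_coeff_ext_corner[OF True] \<beta>(2) by force
  next
    case False
    define N where "N = \<bar>xlog \<beta>\<bar> + \<bar>ylog \<beta>\<bar>"
    have \<beta>': "\<beta> \<in> beta_circle - corner_pts" using \<beta> False by simp
    have "N > 0" using circle_coords(3)[OF \<beta>'] by (auto simp: N_def)
    then have "\<bar>ylog \<beta> / N\<bar> + \<bar>xlog \<beta> / N\<bar> = 1"
      by (simp add: N_def add_divide_distrib[symmetric])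
    moreover have "r = diamond_to_square (ylog \<beta> / N) (xlog \<beta> / N)"
      using surgery_coeff_circle[OF \<beta>'] False \<beta>(2) by (simp add: surgery_coeff_ext_def N_def)
    ultimately show ?thesis by force
  qed
next
  fix r assume "r \<in> (\<lambda>(S, T). diamond_to_square S T) ` {(S, T). \<bar>S\<bar> + \<bar>T\<bar> = 1}"
  then obtain S T where ST: "\<bar>S\<bar> + \<bar>T\<bar> = 1" "r = diamond_to_square S T" by auto
  show "r \<in> surgery_coeff_ext ` beta_circle"
  proof (cases "S = 0 \<or> T = 0")
    case True
    define \<beta> where "\<beta> = complete_pt * (1 + Complex T S)"
    have w: "disc_coord \<beta> = Complex T S" by (simp add: \<beta>_def disc_coord_of)
    have \<beta>: "\<beta> \<in> corner_pts"
      using True ST(1) by (auto simp: corner_pts_iff w complex_eq_iff abs_if split: if_splits)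
    then have "r = surgery_coeff_ext \<beta>" by (simp add: surgery_coeff_ext_corner w ST(2))
    with \<beta> corner_pts_subset_circle show ?thesis by blast
  next
    case False
    with exists_circle_pt_direction[OF ST(1)] obtain \<beta> where \<beta>: "\<beta> \<in> beta_circle - corner_pts"
      and "ylog \<beta> / (\<bar>xlog \<beta>\<bar> + \<bar>ylog \<beta>\<bar>) = S" "xlog \<beta> / (\<bar>xlog \<beta>\<bar> + \<bar>ylog \<beta>\<bar>) = T"
      by blast
    then have "surgery_coeff_ext \<beta> = r"
      using surgery_coeff_circle[OF \<beta>] by (simp add: surgery_coeff_ext_def ST(2))
    with \<beta> show ?thesis by blast
  qed
qed

theorem theorem2:
  shows "(\<forall>\<beta> \<in> beta_circle - corner_pts. real_lin_indep (u_W \<beta>) (v_W \<beta>)) \<and>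
         (\<forall>\<beta> \<in> corner_pts. \<exists>pq. (surgery_coeff \<longlongrightarrow> pq) (at \<beta> within beta_circle)) \<and>
         surgery_coeff_ext ` beta_circle = {(p, q). max \<bar>p\<bar> \<bar>q\<bar> = 2}"
  using u_v_indep_circle surgery_coeff_corner
  unfolding surgery_coeff_ext_image diamond_to_square_image by blast

end
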